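(* Consider a knockout tournament starting with $n=2^\ell$ players, where player $i$ defeats player $j$, independently of all other duels, with probability $1/2$ for all $1\le i\neq j\le n$; the winner of a duel continues to a duel with another winner, and the defeated player is eliminated from the tournament. Let $S_i$ denote the number of games won by player $i$. Assume a completely random schedule (draw) of the matches. Then $S_1,\ldots,S_n$ are negatively associated.
   Context: In a knockout tournament with $2^\ell$ players there are $\ell$ rounds; in each round the remaining players are paired, each pair plays one duel, the losers are eliminated and the winners proceed to the next round, until one champion remains after round $\ell$. A completely random draw means that the assignment of players to the positions of the tournament bracket is a uniformly random permutation, independent of the duel outcomes. Throughout, increasing means nondecreasing. Random variables $S_1,\ldots,S_n$ are said to be negatively associated (NA) if for every pair of disjoint subsets $A_1, A_2$ of $\{1,\ldots,n\}$, $$\mathrm{Cov}\left(f_1(S_i, i\in A_1),\, f_2(S_j, j\in A_2)\right)\leq 0$$ whenever $f_1$ and $f_2$ are real-valued functions, increasing in all coordinates. *)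

theory Defs
  imports "HOL-Probability.Probability" "HOL-Combinatorics.Permutations"
begin

definition covariance :: "'a measure \<Rightarrow> ('a \<Rightarrow> real) \<Rightarrow> ('a \<Rightarrow> real) \<Rightarrow> real" where
  "covariance M X Y =
     (LINT \<omega>|M. (X \<omega> - (LINT \<omega>'|M. X \<omega>')) * (Y \<omega> - (LINT \<omega>'|M. Y \<omega>')))"

text \<open>
  On \<open>A \<rightarrow>\<^sub>E UNIV\<close>, a copy of the functions from \<open>A\<close> to the reals, the
  pointwise order is the coordinatewise order, so \<open>mono_on\<close> says that the
  function is nondecreasing in every coordinate in \<open>A\<close>. The integrability assumptions
  say that the covariance exists, since the library integral of a non-integrable function
  is 0. They also cover measurability: a coordinatewise nondecreasing function of several
  variables need not be Borel measurable. For finitely many finitely-valued random variables they always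
  hold.
\<close>

definition negatively_associated :: "'a measure \<Rightarrow> 'i set \<Rightarrow> ('i \<Rightarrow> 'a \<Rightarrow> real) \<Rightarrow> bool" where
  "negatively_associated M I S \<longleftrightarrow>
     (\<forall>i\<in>I. S i \<in> borel_measurable M) \<and>
     (\<forall>A1 A2 (f1 :: ('i \<Rightarrow> real) \<Rightarrow> real) (f2 :: ('i \<Rightarrow> real) \<Rightarrow> real).
        A1 \<subseteq> I \<longrightarrow> A2 \<subseteq> I \<longrightarrow> A1 \<inter> A2 = {} \<longrightarrow>
        mono_on (A1 \<rightarrow>\<^sub>E UNIV) f1 \<longrightarrow> mono_on (A2 \<rightarrow>\<^sub>E UNIV) f2 \<longrightarrow>
        integrable M (\<lambda>\<omega>. f1 (\<lambda>i\<in>A1. S i \<omega>)) \<longrightarrow>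
        integrable M (\<lambda>\<omega>. f2 (\<lambda>i\<in>A2. S i \<omega>)) \<longrightarrow>
        integrable M (\<lambda>\<omega>. f1 (\<lambda>i\<in>A1. S i \<omega>) * f2 (\<lambda>i\<in>A2. S i \<omega>)) \<longrightarrow>
        covariance M (\<lambda>\<omega>. f1 (\<lambda>i\<in>A1. S i \<omega>)) (\<lambda>\<omega>. f2 (\<lambda>i\<in>A2. S i \<omega>)) \<le> 0)"

text \<open>
  Players and bracket positions are both numbered from 1 to \<open>2 ^ l\<close>. Here \<open>d p\<close> is
  the player drawn into position \<open>p\<close>, and \<open>b i j\<close> says that \<open>i\<close> wins the duel
  between \<open>i\<close> and \<open>j\<close> if it is played. Duel \<open>p\<close> of round \<open>r\<close>, for
  \<open>p\<close> from 1 to \<open>2 ^ (l - r)\<close>, is between the winners of duels \<open>2 * p - 1\<close> and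
  \<open>2 * p\<close> of round \<open>r - 1\<close>; ``round 0'' is the draw.
\<close>

fun duel_winner :: "(nat \<Rightarrow> nat) \<Rightarrow> (nat \<Rightarrow> nat \<Rightarrow> bool) \<Rightarrow> nat \<Rightarrow> nat \<Rightarrow> nat" where
  "duel_winner d b 0 p = d p"
| "duel_winner d b (Suc r) p =
     (let i = duel_winner d b r (2 * p - 1); j = duel_winner d b r (2 * p)
      in if b i j then i else j)"

definition games_won :: "nat \<Rightarrow> (nat \<Rightarrow> nat) \<Rightarrow> (nat \<Rightarrow> nat \<Rightarrow> bool) \<Rightarrow> nat \<Rightarrow> nat" where
  "games_won l d b i =
     card {(r, p). r \<in> {1..l} \<and> p \<in> {1..2 ^ (l - r)} \<and> duel_winner d b r p = i}"

definition duels :: "nat \<Rightarrow> (nat \<times> nat) set" where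
  "duels n = {(i, j). 1 \<le> i \<and> i < j \<and> j \<le> n}"

text \<open>
  Two players meet at most once, so the result of every possible duel can be fixed in
  advance by one fair coin per unordered pair of players, independently of the draw.
  Independence of the draw and the duels is stated for the generated sigma-algebras because
  \<open>indep_var\<close> requires both random variables to have the same type.
\<close>

locale random_knockout = prob_space M for M :: "'a measure" +
  fixes l :: nat
    and draw :: "'a \<Rightarrow> nat \<Rightarrow> nat"
    and beats :: "nat \<Rightarrow> nat \<Rightarrow> 'a \<Rightarrow> bool"
  assumes draw_measurable:
      "draw \<in> measurable M (count_space {d. d permutes {1..2 ^ l}})"
    and draw_uniform:
      "distr M (count_space {d. d permutes {1..2 ^ l}}) draw
         = uniform_count_measure {d. d permutes {1..2 ^ l}}"
    and beats_antisym:
      "\<And>i j \<omega>. i \<in> {1..2 ^ l} \<Longrightarrow> j \<in> {1..2 ^ l} \<Longrightarrow> i \<noteq> j \<Longrightarrow> \<omega> \<in> space M \<Longrightarrow>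
         beats j i \<omega> \<longleftrightarrow> \<not> beats i j \<omega>"
    and beats_fair:
      "\<And>i j. i \<in> {1..2 ^ l} \<Longrightarrow> j \<in> {1..2 ^ l} \<Longrightarrow> i \<noteq> j \<Longrightarrow>
         prob {\<omega> \<in> space M. beats i j \<omega>} = 1 / 2"
    and beats_indep:
      "indep_vars (\<lambda>_. count_space UNIV) (\<lambda>(i, j). beats i j) (duels (2 ^ l))"
    and draw_indep:
      "indep_set
         (sets (vimage_algebra (space M) draw (count_space {d. d permutes {1..2 ^ l}})))
         (sets (vimage_algebra (space M) (\<lambda>\<omega>. \<lambda>(i, j)\<in>duels (2 ^ l). beats i j \<omega>)
           (Pi\<^sub>M (duels (2 ^ l)) (\<lambda>_. count_space UNIV))))"

end

theory Submission
  imports Defs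
begin

text \<open>
  The scores are a uniformly random arrangement of a fixed list of numbers, and such an arrangement
  is negatively associated.

  For the first claim, the number of players who win at least \<open>k\<close> games is
  \<open>2 ^ (l - k)\<close> whatever the draw and the duel results are, so any two runs of the tournament
  have the same multiset of scores (\<open>games_won_rearrangement\<close>). Moreover the draw is uniform,
  the duels are independent fair coins, and the two are independent, so the pair of the draw and
  all duel results is uniform on a finite set (\<open>outcome_uniform\<close>). Renaming the players
  preserves that set, so the scores are exchangeable (\<open>sum_outcomes_exchangeable\<close>). An
  exchangeable vector whose values are always the same up to order is a uniformly random
  arrangement of them (\<open>expectation_of_scores\<close>). Fair coins are essential here: with
  unequal strengths a set of duel results and its renaming need not be equally likely.

  For the second claim (\<open>permutation_distribution_negatively_associated\<close>), let \<open>f\<close> and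
  \<open>g\<close> be increasing in disjoint sets \<open>A\<close> and \<open>B\<close> of coordinates, and condition on
  the index \<open>J\<close> that receives a least value. The remaining values are again uniformly
  arranged, so by induction the conditional covariance is nonpositive. The conditional mean of
  \<open>f\<close> given \<open>J\<close> has one constant value for all \<open>J\<close> outside \<open>A\<close>, and it
  does not exceed it for \<open>J\<close> in \<open>A\<close>; likewise for \<open>g\<close> and \<open>B\<close>. As \<open>A\<close>
  and \<open>B\<close> are disjoint, at most one of the two conditional means falls short of its constant
  at a time, and so they are nonpositively correlated.
\<close>

section \<open>Sums over bijections\<close>

text \<open>
  Values outside \<open>I\<close> are pinned to \<open>undefined\<close>, so that the set is finite for
  finite \<open>I\<close> and \<open>K\<close> and a sum over it counts each bijection once.
\<close>

definition bijections :: "'i set \<Rightarrow> 'k set \<Rightarrow> ('i \<Rightarrow> 'k) set" where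
  "bijections I K = {\<sigma> \<in> I \<rightarrow>\<^sub>E K. bij_betw \<sigma> I K}"

lemma finite_bijections: "finite I \<Longrightarrow> finite K \<Longrightarrow> finite (bijections I K)"
  unfolding bijections_def by (simp add: finite_PiE)

lemma bijections_empty: "bijections {} {} = {\<lambda>_. undefined}"
  by (auto simp: bijections_def bij_betw_def)

lemma fun_upd_in_bijections:
  assumes "j \<in> I" "k \<in> K" "\<tau> \<in> bijections (I - {j}) (K - {k})"
  shows "\<tau>(j := k) \<in> bijections I K"
proof -
  have I: "insert j (I - {j}) = I" and K: "insert k (K - {k}) = K"
    using assms by auto
  have "\<tau>(j := k) \<in> insert j (I - {j}) \<rightarrow>\<^sub>E insert k (K - {k})"
    using assms(3) by (auto simp: bijections_def PiE_def Pi_def extensional_def)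
  moreover have "bij_betw (\<tau>(j := k)) (I - {j}) (K - {k})"
    using assms(3) by (subst bij_betw_cong[of _ _ \<tau>]) (auto simp: bijections_def)
  then have "bij_betw (\<tau>(j := k)) (insert j (I - {j})) (insert k (K - {k}))"
    using notIn_Un_bij_betw[of j "I - {j}" "\<tau>(j := k)" "K - {k}"] by auto
  ultimately show ?thesis unfolding I K bijections_def by simp
qed

lemma restrict_in_bijections:
  assumes "\<sigma> \<in> bijections I K" "j \<in> I"
  shows "restrict \<sigma> (I - {j}) \<in> bijections (I - {j}) (K - {\<sigma> j})"
proof -
  have "bij_betw \<sigma> (I - {j}) (K - {\<sigma> j})"
    using assms by (intro bij_betw_DiffI) (auto simp: bijections_def bij_betw_def)
  then show ?thesis
    unfolding bijections_def by (auto simp: bij_betw_def PiE_def)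
qed

text \<open>
  Conditioning on which index \<open>j\<close> receives the value \<open>k\<close>: what remains is an arbitrary
  bijection between the sets with \<open>j\<close> and \<open>k\<close> removed.
\<close>

lemma sum_bijections_split:
  fixes H :: "('i \<Rightarrow> 'k) \<Rightarrow> 'b::comm_monoid_add"
  assumes "finite I" "finite K" "k \<in> K"
  shows "(\<Sum>\<sigma>\<in>bijections I K. H \<sigma>) =
    (\<Sum>j\<in>I. \<Sum>\<tau>\<in>bijections (I - {j}) (K - {k}). H (\<tau>(j := k)))"
proof -
  have *: "inv_into I \<sigma> k \<in> I" "\<sigma> (inv_into I \<sigma> k) = k" if "\<sigma> \<in> bijections I K" for \<sigma>
    using that assms(3) unfolding bijections_def
    by (auto simp: bij_betw_def intro: inv_into_into f_inv_into_f)
  have "(\<Sum>j\<in>I. \<Sum>\<tau>\<in>bijections (I - {j}) (K - {k}). H (\<tau>(j := k))) =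
    (\<Sum>(j, \<tau>)\<in>(SIGMA j:I. bijections (I - {j}) (K - {k})). H (\<tau>(j := k)))"
    using assms by (intro sum.Sigma) (auto simp: finite_bijections)
  also have "\<dots> = (\<Sum>\<sigma>\<in>bijections I K. H \<sigma>)"
  proof (intro sum.reindex_bij_witness[where
        i = "\<lambda>\<sigma>. (inv_into I \<sigma> k, restrict \<sigma> (I - {inv_into I \<sigma> k}))" and
        j = "\<lambda>(j, \<tau>). \<tau>(j := k)"])
    fix p assume p: "p \<in> (SIGMA j:I. bijections (I - {j}) (K - {k}))"
    obtain j \<tau> where [simp]: "p = (j, \<tau>)" by force
    have j: "j \<in> I" and t: "\<tau> \<in> bijections (I - {j}) (K - {k})" using p by auto
    have u: "\<tau>(j := k) \<in> bijections I K" by (rule fun_upd_in_bijections[OF j assms(3) t])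
    then show "(case p of (j, \<tau>) \<Rightarrow> \<tau>(j := k)) \<in> bijections I K" by simp
    have "inj_on (\<tau>(j := k)) I" using u by (auto simp: bijections_def bij_betw_def)
    then have inv: "inv_into I (\<tau>(j := k)) k = j"
      using inv_into_f_f[of "\<tau>(j := k)" I j] j by simp
    have "restrict (\<tau>(j := k)) (I - {j}) = \<tau>"
      using t by (fastforce simp: bijections_def PiE_def extensional_def fun_eq_iff)
    then show "(inv_into I (case p of (j, \<tau>) \<Rightarrow> \<tau>(j := k)) k,
        restrict (case p of (j, \<tau>) \<Rightarrow> \<tau>(j := k)) (I - {inv_into I (case p of (j, \<tau>) \<Rightarrow> \<tau>(j := k)) k})) = p"
      using inv by simp
    show "H (case p of (j, \<tau>) \<Rightarrow> \<tau>(j := k)) = (case p of (j, \<tau>) \<Rightarrow> H (\<tau>(j := k)))" by simp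
  next
    fix \<sigma> assume s: "\<sigma> \<in> bijections I K"
    show "(inv_into I \<sigma> k, restrict \<sigma> (I - {inv_into I \<sigma> k})) \<in> (SIGMA j:I. bijections (I - {j}) (K - {k}))"
      using restrict_in_bijections[OF s *(1)[OF s]] *[OF s] by simp
    show "(case (inv_into I \<sigma> k, restrict \<sigma> (I - {inv_into I \<sigma> k})) of (j, \<tau>) \<Rightarrow> \<tau>(j := k)) = \<sigma>"
      using *[OF s] s by (fastforce simp: bijections_def PiE_def extensional_def fun_eq_iff)
  qed
  finally show ?thesis by simp
qed

lemma sum_bijections_relabel:
  fixes H :: "('i \<Rightarrow> 'k) \<Rightarrow> 'b::comm_monoid_add"
  assumes "bij \<pi>"
  shows "(\<Sum>\<sigma>\<in>bijections J K. H \<sigma>) = (\<Sum>\<sigma>\<in>bijections (\<pi> ` J) K. H (\<sigma> \<circ> \<pi>))"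
proof -
  have inv: "\<And>x. inv \<pi> (\<pi> x) = x" "\<And>x. \<pi> (inv \<pi> x) = x"
    using assms by (simp_all add: bij_is_inj bij_is_surj surj_f_inv_f)
  have inj: "inj_on \<pi> J" using assms by (meson bij_is_inj inj_on_subset subset_UNIV)
  show ?thesis
  proof (intro sum.reindex_bij_witness[where i = "\<lambda>\<sigma>. \<sigma> \<circ> \<pi>" and j = "\<lambda>\<sigma>. \<sigma> \<circ> inv \<pi>"])
    fix \<sigma> assume s: "\<sigma> \<in> bijections J K"
    have "bij_betw (inv \<pi>) (\<pi> ` J) J"
      using inv by (intro bij_betwI[where g = \<pi>]) auto
    then have "bij_betw (\<sigma> \<circ> inv \<pi>) (\<pi> ` J) K"
      using s by (auto simp: bijections_def intro: bij_betw_trans)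
    moreover have "inv \<pi> x \<notin> J" if "x \<notin> \<pi> ` J" for x
      using that inv(2) by (metis imageI)
    ultimately show "\<sigma> \<circ> inv \<pi> \<in> bijections (\<pi> ` J) K"
      using s inv by (auto simp: bijections_def PiE_def extensional_def)
  next
    fix \<sigma> assume s: "\<sigma> \<in> bijections (\<pi> ` J) K"
    have "bij_betw \<pi> J (\<pi> ` J)" using inj by (simp add: bij_betw_def)
    then have "bij_betw (\<sigma> \<circ> \<pi>) J K"
      using s by (auto simp: bijections_def intro: bij_betw_trans)
    moreover have "\<pi> x \<notin> \<pi> ` J" if "x \<notin> J" for x
      using that inv(1) by (metis image_iff)
    ultimately show "\<sigma> \<circ> \<pi> \<in> bijections J K"
      using s by (auto simp: bijections_def PiE_def extensional_def)
  qed (auto simp: comp_def inv)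
qed

text \<open>
  A permutation of \<open>I\<close> is the identity outside \<open>I\<close>, whereas an element of
  \<open>bijections I I\<close> is \<open>undefined\<close> there; a summand that looks only at \<open>I\<close> does not
  see the difference.
\<close>

lemma sum_permutes_eq_sum_bijections:
  fixes G :: "('i \<Rightarrow> 'i) \<Rightarrow> 'b::comm_monoid_add"
  assumes "\<And>\<sigma> \<tau>. (\<forall>i\<in>I. \<sigma> i = \<tau> i) \<Longrightarrow> G \<sigma> = G \<tau>"
  shows "(\<Sum>\<pi> | \<pi> permutes I. G \<pi>) = (\<Sum>\<sigma>\<in>bijections I I. G \<sigma>)"
proof (intro sum.reindex_bij_witness[where
      i = "\<lambda>\<sigma> x. if x \<in> I then \<sigma> x else x" and j = "\<lambda>\<pi>. restrict \<pi> I"])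
  fix \<pi> assume p: "\<pi> \<in> {\<pi>. \<pi> permutes I}"
  then show "(\<lambda>x. if x \<in> I then restrict \<pi> I x else x) = \<pi>"
    by (auto simp: permutes_def fun_eq_iff)
  show "restrict \<pi> I \<in> bijections I I"
    using p permutes_imp_bij[of \<pi> I] by (auto simp: bijections_def permutes_in_image)
  show "G (restrict \<pi> I) = G \<pi>" by (rule assms) simp
next
  fix \<sigma> assume s: "\<sigma> \<in> bijections I I"
  then show "(\<lambda>x\<in>I. if x \<in> I then \<sigma> x else x) = \<sigma>"
    by (auto simp: bijections_def fun_eq_iff PiE_def extensional_def)
  have "bij_betw (\<lambda>x. if x \<in> I then \<sigma> x else x) I I"
    using s by (subst bij_betw_cong[of _ _ \<sigma>]) (auto simp: bijections_def)
  then show "(\<lambda>x. if x \<in> I then \<sigma> x else x) \<in> {\<pi>. \<pi> permutes I}"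
    by (auto intro: bij_imp_permutes)
qed

section \<open>Negative association of a random arrangement\<close>

text \<open>
  The two vectors are compared on \<open>A\<close> only, so this says at once that \<open>f\<close> depends on the
  coordinates in \<open>A\<close> alone and is nondecreasing in them. Arguments are thus arbitrary vectors,
  and no restriction to \<open>A\<close> has to be carried along.
\<close>

definition increasing_in :: "'i set \<Rightarrow> (('i \<Rightarrow> real) \<Rightarrow> real) \<Rightarrow> bool" where
  "increasing_in A f \<longleftrightarrow> (\<forall>s t. (\<forall>i\<in>A. s i \<le> t i) \<longrightarrow> f s \<le> f t)"

lemma increasing_inD: "increasing_in A f \<Longrightarrow> (\<And>i. i \<in> A \<Longrightarrow> s i \<le> t i) \<Longrightarrow> f s \<le> f t"
  unfolding increasing_in_def by blast

lemma increasing_in_cong: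
  assumes f: "increasing_in A f" and "\<And>i. i \<in> A \<Longrightarrow> s i = t i"
  shows "f s = f t"
  by (rule antisym; rule increasing_inD[OF f]) (simp_all add: assms(2))

lemma increasing_in_fun_upd:
  "increasing_in A f \<Longrightarrow> increasing_in (A - {j}) (\<lambda>s. f (s(j := x)))"
  unfolding increasing_in_def by simp

lemma increasing_in_restrict:
  assumes "mono_on (A \<rightarrow>\<^sub>E UNIV) f"
  shows "increasing_in A (\<lambda>s. f (restrict s A))"
  unfolding increasing_in_def
  by (intro allI impI mono_onD[OF assms]) (auto simp: le_fun_def)

text \<open>
  Here \<open>a j\<close> is, up to normalization, the mean of \<open>f\<close> given that the least value sits at
  \<open>j\<close>. If \<open>j\<close> is outside \<open>A\<close>, then \<open>f\<close> sees an arrangement of the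
  other values only, and by symmetry the mean is the same for all such \<open>j\<close>. If \<open>j\<close> is
  in \<open>A\<close>, exchanging the roles of \<open>j\<close> and some \<open>i\<close> outside \<open>A\<close> replaces the
  least value at \<open>j\<close> by another one and leaves the rest of \<open>A\<close> alone, so the mean can
  only be smaller.
\<close>

lemma sum_given_argmin_le_common_value:
  fixes v :: "'k \<Rightarrow> real"
  assumes fin: "finite I" and f: "increasing_in A f"
    and k: "k \<in> K" "\<And>k'. k' \<in> K \<Longrightarrow> v k \<le> v k'"
  defines "a \<equiv> \<lambda>j. \<Sum>\<tau>\<in>bijections (I - {j}) (K - {k}). f ((v \<circ> \<tau>)(j := v k))"
  shows "\<exists>c. \<forall>j\<in>I. a j \<le> c \<and> (j \<notin> A \<longrightarrow> a j = c)"
proof (cases "I \<subseteq> A")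
  case True
  \<comment> \<open>With no index outside \<open>A\<close>, any upper bound will do.\<close>
  then show ?thesis
    using fin by (intro exI[of _ "Max (a ` I)"]) auto
next
  case False
  then obtain i where i: "i \<in> I" "i \<notin> A" by blast
  \<comment> \<open>Transposing \<open>i\<close> and \<open>j\<close> puts both conditional sums over the same bijections.\<close>
  have shift: "a i = (\<Sum>\<tau>\<in>bijections (I - {j}) (K - {k}). f (v \<circ> \<tau> \<circ> Transposition.transpose i j))"
    if "j \<in> I" for j
  proof -
    have "a i = (\<Sum>\<tau>\<in>bijections (I - {i}) (K - {k}). f (v \<circ> \<tau>))"
      unfolding a_def
    proof (rule sum.cong[OF refl])
      show "f ((v \<circ> \<tau>)(i := v k)) = f (v \<circ> \<tau>)" for \<tau>
        by (rule increasing_in_cong[OF f]) (use i in auto)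
    qed
    also have "\<dots> = (\<Sum>\<tau>\<in>bijections (Transposition.transpose i j ` (I - {i})) (K - {k}). f (v \<circ> (\<tau> \<circ> Transposition.transpose i j)))"
      by (rule sum_bijections_relabel) simp
    also have "Transposition.transpose i j ` (I - {i}) = I - {j}"
      using i that by (auto simp: image_iff Transposition.transpose_def)
    finally show ?thesis by (simp only: comp_assoc)
  qed
  have "a j \<le> a i" if j: "j \<in> I" for j
    unfolding shift[OF j] unfolding a_def
  proof (rule sum_mono, rule increasing_inD[OF f])
    fix \<tau> h assume t: "\<tau> \<in> bijections (I - {j}) (K - {k})" and h: "h \<in> A"
    show "((v \<circ> \<tau>)(j := v k)) h \<le> (v \<circ> \<tau> \<circ> Transposition.transpose i j) h"
    proof (cases "h = j")
      case True
      then have "i \<in> I - {j}" using i h by auto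
      then have "\<tau> i \<in> K" using t by (auto simp: bijections_def)
      with True show ?thesis by (simp add: k)
    next
      case False
      with h i have "Transposition.transpose i j h = h" by (auto simp: Transposition.transpose_def)
      with False show ?thesis by simp
    qed
  qed
  moreover have "a j = a i" if j: "j \<in> I" "j \<notin> A" for j
    unfolding shift[OF j(1)] unfolding a_def
  proof (rule sum.cong[OF refl])
    show "f ((v \<circ> \<tau>)(j := v k)) = f (v \<circ> \<tau> \<circ> Transposition.transpose i j)" for \<tau>
      by (rule increasing_in_cong[OF f]) (use i j in \<open>auto simp: Transposition.transpose_def\<close>)
  qed
  ultimately show ?thesis by blast
qed

text \<open>
  The deficits \<open>c - a j\<close> and \<open>e - b j\<close> are nonnegative and live on disjoint sets, so their
  product vanishes identically, while the product of their sums is nonnegative. Their covariance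
  under the uniform distribution on \<open>I\<close> is therefore nonpositive, and it equals that of
  \<open>a\<close> and \<open>b\<close>.
\<close>

lemma sum_mult_le_of_disjoint_deficits:
  fixes a b :: "'i \<Rightarrow> real"
  assumes a: "\<And>j. j \<in> I \<Longrightarrow> a j \<le> c" "\<And>j. j \<in> I \<Longrightarrow> j \<notin> A \<Longrightarrow> a j = c"
    and b: "\<And>j. j \<in> I \<Longrightarrow> b j \<le> e" "\<And>j. j \<in> I \<Longrightarrow> j \<notin> B \<Longrightarrow> b j = e"
    and disj: "A \<inter> B = {}"
  shows "real (card I) * (\<Sum>j\<in>I. a j * b j) \<le> (\<Sum>j\<in>I. a j) * (\<Sum>j\<in>I. b j)"
proof -
  have "(c - a j) * (e - b j) = 0" if "j \<in> I" for j
    using a(2)[OF that] b(2)[OF that] disj by auto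
  then have "a j * b j = c * b j + e * a j - c * e" if "j \<in> I" for j
    using that by (fastforce simp: algebra_simps)
  then have "(\<Sum>j\<in>I. a j * b j) = c * (\<Sum>j\<in>I. b j) + e * (\<Sum>j\<in>I. a j) - card I * (c * e)"
    by (simp add: sum.distrib sum_subtractf sum_distrib_left)
  then have "real (card I) * (\<Sum>j\<in>I. a j * b j) =
      real (card I) * (c * (\<Sum>j\<in>I. b j) + e * (\<Sum>j\<in>I. a j) - card I * (c * e))"
    by simp
  moreover have "0 \<le> (\<Sum>j\<in>I. c - a j) * (\<Sum>j\<in>I. e - b j)"
    using a(1) b(1) by (intro mult_nonneg_nonneg sum_nonneg) auto
  then have "0 \<le> (card I * c - (\<Sum>j\<in>I. a j)) * (card I * e - (\<Sum>j\<in>I. b j))"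
    by (simp add: sum_subtractf)
  ultimately show ?thesis
    by (simp add: algebra_simps)
qed

text \<open>
  Negative association of a uniformly random arrangement of the values \<open>v\<close> along \<open>I\<close>,
  multiplied through by the square of the number \<open>fact (card I)\<close> of arrangements. Given the
  position of a least value, the other values form a uniformly random arrangement on one index less,
  so the conditional covariance is nonpositive by induction; the covariance of the conditional means
  is nonpositive by the two preceding lemmas. The law of total covariance adds the two.
\<close>

theorem permutation_distribution_negatively_associated:
  fixes v :: "'k \<Rightarrow> real"
  assumes "finite I" "finite K" "card I = card K"
    and "increasing_in A f" "increasing_in B g" "A \<inter> B = {}"
  shows "fact (card I) * (\<Sum>\<sigma>\<in>bijections I K. f (v \<circ> \<sigma>) * g (v \<circ> \<sigma>))
    \<le> (\<Sum>\<sigma>\<in>bijections I K. f (v \<circ> \<sigma>)) * (\<Sum>\<sigma>\<in>bijections I K. g (v \<circ> \<sigma>))"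
  using assms
proof (induction "card I" arbitrary: I K A B f g)
  case 0
  then have "I = {}" "K = {}" by auto
  then have "bijections I K = {\<lambda>_. undefined}" by (simp add: bijections_empty)
  then show ?case using \<open>I = {}\<close> by simp
next
  case (Suc n)
  note fin = Suc.prems(1,2)
  have "K \<noteq> {}" using Suc.hyps(2) Suc.prems(3) by auto
  then obtain k where k: "k \<in> K" "\<And>k'. k' \<in> K \<Longrightarrow> v k \<le> v k'"
    using arg_min_if_finite[OF fin(2)] by (metis not_le)
  define a where "a j = (\<Sum>\<tau>\<in>bijections (I - {j}) (K - {k}). f ((v \<circ> \<tau>)(j := v k)))" for j
  define b where "b j = (\<Sum>\<tau>\<in>bijections (I - {j}) (K - {k}). g ((v \<circ> \<tau>)(j := v k)))" for j
  define h where "h j = (\<Sum>\<tau>\<in>bijections (I - {j}) (K - {k}).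
    f ((v \<circ> \<tau>)(j := v k)) * g ((v \<circ> \<tau>)(j := v k)))" for j
  have comp: "v \<circ> \<tau>(j := k) = (v \<circ> \<tau>)(j := v k)" for \<tau> :: "'a \<Rightarrow> 'k" and j
    by (auto simp: fun_eq_iff)
  have split: "(\<Sum>\<sigma>\<in>bijections I K. f (v \<circ> \<sigma>)) = (\<Sum>j\<in>I. a j)"
    "(\<Sum>\<sigma>\<in>bijections I K. g (v \<circ> \<sigma>)) = (\<Sum>j\<in>I. b j)"
    "(\<Sum>\<sigma>\<in>bijections I K. f (v \<circ> \<sigma>) * g (v \<circ> \<sigma>)) = (\<Sum>j\<in>I. h j)"
    unfolding a_def b_def h_def sum_bijections_split[OF fin k(1)] comp by simp_all
  have IH: "fact n * h j \<le> a j * b j" if j: "j \<in> I" for j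
  proof -
    have n: "n = card (I - {j})" using Suc.hyps(2) j fin by simp
    show ?thesis
      unfolding a_def b_def h_def
      using Suc.hyps(1)[OF n, of "K - {k}" "A - {j}" "\<lambda>s. f (s(j := v k))" "B - {j}" "\<lambda>s. g (s(j := v k))"]
        Suc.prems k(1) j n
      by (auto simp: increasing_in_fun_upd)
  qed
  obtain c where c: "\<forall>j\<in>I. a j \<le> c \<and> (j \<notin> A \<longrightarrow> a j = c)"
    using sum_given_argmin_le_common_value[of I A _ k K v, OF fin(1) Suc.prems(4) k] unfolding a_def by blast
  obtain e where e: "\<forall>j\<in>I. b j \<le> e \<and> (j \<notin> B \<longrightarrow> b j = e)"
    using sum_given_argmin_le_common_value[of I B _ k K v, OF fin(1) Suc.prems(5) k] unfolding b_def by blast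
  have "fact (card I) * (\<Sum>j\<in>I. h j) = real (card I) * (\<Sum>j\<in>I. fact n * h j)"
    by (simp add: sum_distrib_left mult.assoc flip: Suc.hyps(2))
  also have "\<dots> \<le> real (card I) * (\<Sum>j\<in>I. a j * b j)"
    using IH by (intro mult_left_mono sum_mono) auto
  also have "\<dots> \<le> (\<Sum>j\<in>I. a j) * (\<Sum>j\<in>I. b j)"
    by (rule sum_mult_le_of_disjoint_deficits[of I a c A b e B]) (use c e Suc.prems(6) in auto)
  finally show ?case unfolding split .
qed

section \<open>The multiset of scores is deterministic\<close>

lemma duel_winner_Suc_cases:
  "duel_winner d b (Suc r) p = duel_winner d b r (2 * p - 1) \<or>
   duel_winner d b (Suc r) p = duel_winner d b r (2 * p)"
  by (simp add: Let_def)

lemma duel_slots_of_previous_round: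
  fixes p :: nat
  assumes "Suc r \<le> l" "p \<in> {1..2 ^ (l - Suc r)}"
  shows "2 * p - 1 \<in> {1..2 ^ (l - r)}" "2 * p \<in> {1..2 ^ (l - r)}"
proof -
  have "l - r = Suc (l - Suc r)" using assms(1) by simp
  then have "(2::nat) ^ (l - r) = 2 * 2 ^ (l - Suc r)" by simp
  then show "2 * p - 1 \<in> {1..2 ^ (l - r)}" "2 * p \<in> {1..2 ^ (l - r)}"
    using assms(2) by auto
qed

lemma inj_on_duel_winner:
  assumes "inj_on d {1..2 ^ l}" "r \<le> l"
  shows "inj_on (duel_winner d b r) {1..2 ^ (l - r)}"
  using assms(2)
proof (induction r)
  case 0
  then show ?case using assms(1) by (simp add: inj_on_def)
next
  case (Suc r)
  then have IH: "inj_on (duel_winner d b r) {1..2 ^ (l - r)}" by simp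
  show ?case
  proof (rule inj_onI)
    fix p q assume p: "p \<in> {1..2 ^ (l - Suc r)}" and q: "q \<in> {1..2 ^ (l - Suc r)}"
      and eq: "duel_winner d b (Suc r) p = duel_winner d b (Suc r) q"
    obtain p' where p': "p' = 2 * p - 1 \<or> p' = 2 * p" "duel_winner d b (Suc r) p = duel_winner d b r p'"
      using duel_winner_Suc_cases by metis
    obtain q' where q': "q' = 2 * q - 1 \<or> q' = 2 * q" "duel_winner d b (Suc r) q = duel_winner d b r q'"
      using duel_winner_Suc_cases by metis
    have "p' \<in> {1..2 ^ (l - r)}" "q' \<in> {1..2 ^ (l - r)}"
      using duel_slots_of_previous_round[OF Suc.prems p] duel_slots_of_previous_round[OF Suc.prems q] p'(1) q'(1) by auto
    then have "p' = q'" using inj_onD[OF IH] eq p'(2) q'(2) by simp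
    then show "p = q" using p'(1) q'(1) p q by auto
  qed
qed

lemma duel_winner_in_players:
  assumes "d ` {1..2 ^ l} \<subseteq> I" "r \<le> l" "p \<in> {1..2 ^ (l - r)}"
  shows "duel_winner d b r p \<in> I"
  using assms(2,3)
proof (induction r arbitrary: p)
  case 0
  then show ?case using assms(1) by auto
next
  case (Suc r)
  show ?case
    using duel_winner_Suc_cases[of d b r p] Suc.IH[of "2 * p - 1"] Suc.IH[of "2 * p"]
      duel_slots_of_previous_round[OF Suc.prems] Suc.prems(1) by (metis Suc_leD)
qed

text \<open>
  The bracket never asks for a duel of a player against himself, because the winners of different
  duels in a round are different players; so agreement off the diagonal suffices.
\<close>

lemma duel_winner_cong:
  assumes d: "d permutes {1..2 ^ l}" and "r \<le> l" "p \<in> {1..2 ^ (l - r)}"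
    and b: "\<And>i j. i \<in> {1..2 ^ l} \<Longrightarrow> j \<in> {1..2 ^ l} \<Longrightarrow> i \<noteq> j \<Longrightarrow> b i j = b' i j"
  shows "duel_winner d b r p = duel_winner d b' r p"
  using assms(2,3)
proof (induction r arbitrary: p)
  case 0
  then show ?case by simp
next
  case (Suc r)
  let ?i = "duel_winner d b r (2 * p - 1)" and ?j = "duel_winner d b r (2 * p)"
  note slots = duel_slots_of_previous_round[OF Suc.prems]
  have r: "r \<le> l" using Suc.prems(1) by simp
  have "inj_on d {1..2 ^ l}" using d by (rule permutes_inj_on)
  from inj_on_duel_winner[OF this r, of b] slots Suc.prems(2) have "?i \<noteq> ?j"
    by (auto dest: inj_onD)
  moreover have "d ` {1..2 ^ l} \<subseteq> {1..2 ^ l}" using permutes_image[OF d] by simp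
  then have "?i \<in> {1..2 ^ l}" "?j \<in> {1..2 ^ l}"
    using duel_winner_in_players[OF _ r] slots by blast+
  ultimately show ?case
    using Suc.IH[OF r slots(1)] Suc.IH[OF r slots(2)] b by (simp add: Let_def)
qed

lemma games_won_cong:
  assumes "d permutes {1..2 ^ l}"
    and "\<And>i j. i \<in> {1..2 ^ l} \<Longrightarrow> j \<in> {1..2 ^ l} \<Longrightarrow> i \<noteq> j \<Longrightarrow> b i j = b' i j"
  shows "games_won l d b i = games_won l d b' i"
proof -
  have "duel_winner d b r p = duel_winner d b' r p" if "r \<in> {1..l}" "p \<in> {1..2 ^ (l - r)}" for r p
    by (rule duel_winner_cong[OF assms(1)]) (use that assms(2) in auto)
  then show ?thesis
    unfolding games_won_def by (intro arg_cong[of _ _ card]) auto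
qed

definition round_winners :: "nat \<Rightarrow> (nat \<Rightarrow> nat) \<Rightarrow> (nat \<Rightarrow> nat \<Rightarrow> bool) \<Rightarrow> nat \<Rightarrow> nat set" where
  "round_winners l d b r = duel_winner d b r ` {1..2 ^ (l - r)}"

lemma round_winners_decreasing:
  assumes "r \<le> r'" "r' \<le> l"
  shows "round_winners l d b r' \<subseteq> round_winners l d b r"
  using assms
proof (induction r' rule: dec_induct)
  case base
  show ?case by simp
next
  case (step k)
  have "round_winners l d b (Suc k) \<subseteq> round_winners l d b k"
    unfolding round_winners_def
  proof (rule image_subsetI)
    fix p :: nat assume "p \<in> {1..2 ^ (l - Suc k)}"
    from duel_slots_of_previous_round[OF step.prems this]
    show "duel_winner d b (Suc k) p \<in> duel_winner d b k ` {1..2 ^ (l - k)}"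
      using duel_winner_Suc_cases[of d b k p] by (metis imageI)
  qed
  then show ?case using step by simp
qed

lemma games_won_eq_card_rounds:
  assumes "inj_on d {1..2 ^ l}"
  shows "games_won l d b i = card {r \<in> {1..l}. i \<in> round_winners l d b r}"
proof -
  let ?S = "{(r, p). r \<in> {1..l} \<and> p \<in> {1..2 ^ (l - r)} \<and> duel_winner d b r p = i}"
  have "inj_on fst ?S"
  proof (rule inj_onI)
    fix x y assume xy: "x \<in> ?S" "y \<in> ?S" "fst x = fst y"
    then have "inj_on (duel_winner d b (fst x)) {1..2 ^ (l - fst x)}"
      by (intro inj_on_duel_winner[OF assms]) auto
    moreover have "snd x \<in> {1..2 ^ (l - fst x)}" "snd y \<in> {1..2 ^ (l - fst x)}"
      "duel_winner d b (fst x) (snd x) = duel_winner d b (fst x) (snd y)"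
      using xy by auto
    ultimately have "snd x = snd y" by (meson inj_onD)
    with xy(3) show "x = y" by (simp add: prod_eq_iff)
  qed
  then have "games_won l d b i = card (fst ` ?S)"
    unfolding games_won_def by (rule card_image[symmetric])
  also have "fst ` ?S = {r \<in> {1..l}. i \<in> round_winners l d b r}"
  proof (intro set_eqI iffI)
    fix r assume "r \<in> {r \<in> {1..l}. i \<in> round_winners l d b r}"
    then obtain p where "(r, p) \<in> ?S" unfolding round_winners_def by blast
    then show "r \<in> fst ` ?S" by (rule rev_image_eqI) simp
  qed (auto simp: round_winners_def)
  finally show ?thesis .
qed

text \<open>
  A winner of round \<open>k\<close> has won all earlier rounds, so the rounds won by a player form an
  initial segment of \<open>{1..l}\<close>.
\<close>

lemma at_least_games_won_iff:
  assumes "inj_on d {1..2 ^ l}" "1 \<le> k" "k \<le> l"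
  shows "k \<le> games_won l d b i \<longleftrightarrow> i \<in> round_winners l d b k"
proof
  let ?R = "{r \<in> {1..l}. i \<in> round_winners l d b r}"
  assume k: "k \<le> games_won l d b i"
  show "i \<in> round_winners l d b k"
  proof (rule ccontr)
    assume "i \<notin> round_winners l d b k"
    then have "?R \<subseteq> {1..<k}"
      using round_winners_decreasing[of k _ l d b] by (fastforce simp: not_le[symmetric])
    then have "card ?R \<le> card {1..<k}" by (intro card_mono) auto
    then show False using k assms by (simp add: games_won_eq_card_rounds)
  qed
next
  let ?R = "{r \<in> {1..l}. i \<in> round_winners l d b r}"
  assume "i \<in> round_winners l d b k"
  then have "{1..k} \<subseteq> ?R"
    using round_winners_decreasing[of _ k l d b] assms(3) by fastforce
  then have "card {1..k} \<le> card ?R" by (intro card_mono) auto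
  then show "k \<le> games_won l d b i" using assms by (simp add: games_won_eq_card_rounds)
qed

lemma card_at_least_games_won:
  assumes d: "d permutes {1..2 ^ l}"
  shows "card {i \<in> {1..2 ^ l}. k \<le> games_won l d b i} = (if k \<le> l then 2 ^ (l - k) else 0)"
proof -
  have inj: "inj_on d {1..2 ^ l}" using d by (rule permutes_inj_on)
  consider "k = 0" | "1 \<le> k" "k \<le> l" | "l < k" by linarith
  then show ?thesis
  proof cases
    case 1
    then have "{i \<in> {1..2 ^ l}. k \<le> games_won l d b i} = {1..2 ^ l}" by auto
    then show ?thesis using 1 by simp
  next
    case 2
    have "round_winners l d b k \<subseteq> {1..2 ^ l}"
      unfolding round_winners_def using permutes_image[OF d] 2
      by (intro image_subsetI duel_winner_in_players[where l = l]) auto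
    then have "{i \<in> {1..2 ^ l}. k \<le> games_won l d b i} = round_winners l d b k"
      using at_least_games_won_iff[OF inj 2] by auto
    moreover have "card (round_winners l d b k) = 2 ^ (l - k)"
      unfolding round_winners_def using inj_on_duel_winner[OF inj 2(2)] by (simp add: card_image)
    ultimately show ?thesis using 2 by simp
  next
    case 3
    have "games_won l d b i \<le> card {1..l}" for i
      unfolding games_won_eq_card_rounds[OF inj] by (intro card_mono) auto
    then have "\<not> k \<le> games_won l d b i" for i
      using 3 by (simp add: not_le le_less_trans[of _ l])
    then show ?thesis using 3 by simp
  qed
qed

text \<open>
  The bracket alone determines how many players win at least \<open>k\<close> games, hence also how many win
  exactly \<open>k\<close>. Two runs of the tournament therefore give the same multiset of scores.
\<close>

lemma games_won_rearrangement:
  assumes d: "d permutes {1..2 ^ l}" and d': "d' permutes {1..2 ^ l}"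
  obtains \<pi> where "\<pi> permutes {1..2 ^ l}"
    "\<forall>i\<in>{1..2 ^ l}. games_won l d b i = games_won l d' b' (\<pi> i)"
proof -
  let ?I = "{1..2 ^ l} :: nat set"
  \<comment> \<open>Natural-number subtraction is harmless: the second set is contained in the first.\<close>
  have exactly: "card {i \<in> ?I. s i = k} = card {i \<in> ?I. k \<le> s i} - card {i \<in> ?I. Suc k \<le> s i}"
    for s :: "nat \<Rightarrow> nat" and k
  proof -
    have "{i \<in> ?I. s i = k} = {i \<in> ?I. k \<le> s i} - {i \<in> ?I. Suc k \<le> s i}" by auto
    then show ?thesis by (simp add: card_Diff_subset Collect_mono)
  qed
  have "image_mset (games_won l d b) (mset_set ?I) = image_mset (games_won l d' b') (mset_set ?I)"
  proof (rule multiset_eqI)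
    fix k
    have count: "count (image_mset s (mset_set ?I)) k = card {i \<in> ?I. s i = k}" for s :: "nat \<Rightarrow> nat"
    proof -
      have "count (image_mset s (mset_set ?I)) k = (\<Sum>x | x \<in> ?I \<and> k = s x. count (mset_set ?I) x)"
        by (simp only: count_image_mset' finite_set_mset_mset_set finite_atLeastAtMost)
      also have "\<dots> = (\<Sum>x | x \<in> ?I \<and> k = s x. 1)"
        by (rule sum.cong) (simp_all only: count_mset_set finite_atLeastAtMost mem_Collect_eq)
      also have "\<dots> = card {i \<in> ?I. k = s i}" by (rule card_eq_sum[symmetric])
      finally show ?thesis by (simp only: eq_commute)
    qed
    show "count (image_mset (games_won l d b) (mset_set ?I)) k =
      count (image_mset (games_won l d' b') (mset_set ?I)) k"
      unfolding count exactly card_at_least_games_won[OF d] card_at_least_games_won[OF d'] ..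
  qed
  from image_mset_eq_implies_permutes[OF _ this] show ?thesis using that by blast
qed

section \<open>Exchangeability under renaming of the players\<close>

lemma duel_winner_relabel:
  assumes "inj \<pi>"
  shows "duel_winner (\<pi> \<circ> d) (\<lambda>i j. b (inv \<pi> i) (inv \<pi> j)) r p = \<pi> (duel_winner d b r p)"
  by (induction r arbitrary: p) (simp_all add: Let_def assms)

lemma games_won_relabel:
  assumes "bij \<pi>"
  shows "games_won l (\<pi> \<circ> d) (\<lambda>i j. b (inv \<pi> i) (inv \<pi> j)) i = games_won l d b (inv \<pi> i)"
proof -
  have "\<pi> x = i \<longleftrightarrow> x = inv \<pi> i" for x
    using bij_inv_eq_iff[OF assms, of x i] by metis
  then show ?thesis
    unfolding games_won_def duel_winner_relabel[OF bij_is_inj[OF assms], of d b] by (simp only:)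
qed

text \<open>
  Complete sets of duel results among the players in \<open>I\<close>. The value is fixed to
  \<open>False\<close> on the diagonal and outside \<open>I\<close>, which makes the set finite for finite \<open>I\<close>
  and represents each set of results once.
\<close>

definition tournaments :: "nat set \<Rightarrow> (nat \<Rightarrow> nat \<Rightarrow> bool) set" where
  "tournaments I = {b. (\<forall>i j. b i j \<longrightarrow> i \<in> I \<and> j \<in> I \<and> i \<noteq> j) \<and>
     (\<forall>i\<in>I. \<forall>j\<in>I. i \<noteq> j \<longrightarrow> b j i = (\<not> b i j))}"

lemma finite_tournaments:
  assumes "finite I"
  shows "finite (tournaments I)"
proof (rule inj_on_finite[where f = "\<lambda>b. {(i, j). b i j}" and B = "Pow (I \<times> I)"])
  show "inj_on (\<lambda>b. {(i, j). b i j}) (tournaments I)"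
  proof (rule inj_onI)
    fix b b' :: "nat \<Rightarrow> nat \<Rightarrow> bool" assume eq: "{(i, j). b i j} = {(i, j). b' i j}"
    have "b i j = b' i j" for i j
      using arg_cong[OF eq, of "\<lambda>S. (i, j) \<in> S"] by simp
    then show "b = b'" by (intro ext)
  qed
  show "(\<lambda>b. {(i, j). b i j}) ` tournaments I \<subseteq> Pow (I \<times> I)"
  proof (intro image_subsetI PowI subsetI)
    fix b x assume "b \<in> tournaments I" "x \<in> {(i, j). b i j}"
    then show "x \<in> I \<times> I" unfolding tournaments_def by blast
  qed
qed (use assms in simp)

lemma relabel_in_tournaments:
  assumes "\<pi> permutes I" "b \<in> tournaments I"
  shows "(\<lambda>i j. b (\<pi> i) (\<pi> j)) \<in> tournaments I"
proof -
  have mem: "\<pi> x \<in> I \<longleftrightarrow> x \<in> I" for x by (rule permutes_in_image[OF assms(1)])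
  have eq: "\<pi> x = \<pi> y \<longleftrightarrow> x = y" for x y by (rule inj_eq[OF permutes_inj[OF assms(1)]])
  have "i \<in> I \<and> j \<in> I \<and> i \<noteq> j" if "b (\<pi> i) (\<pi> j)" for i j
    using assms(2) that mem[of i] mem[of j] eq[of i j] unfolding tournaments_def by blast
  moreover have "b (\<pi> j) (\<pi> i) = (\<not> b (\<pi> i) (\<pi> j))" if "i \<in> I" "j \<in> I" "i \<noteq> j" for i j
    using assms(2) that mem[of i] mem[of j] eq[of i j] unfolding tournaments_def by blast
  ultimately show ?thesis unfolding tournaments_def by blast
qed

definition outcomes :: "nat \<Rightarrow> ((nat \<Rightarrow> nat) \<times> (nat \<Rightarrow> nat \<Rightarrow> bool)) set" where
  "outcomes l = {d. d permutes {1..2 ^ l}} \<times> tournaments {1..2 ^ l}"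

lemma finite_outcomes: "finite (outcomes l)"
  by (simp add: outcomes_def finite_tournaments finite_permutations)

text \<open>
  Renaming the players in the draw and in the duel results together is a bijection of
  \<open>outcomes l\<close>, and it permutes the scores.
\<close>

lemma sum_outcomes_exchangeable:
  fixes F :: "(nat \<Rightarrow> real) \<Rightarrow> real"
  assumes \<pi>: "\<pi> permutes {1..2 ^ l}"
  shows "(\<Sum>(d, b)\<in>outcomes l. F (\<lambda>i. real (games_won l d b (\<pi> i)))) =
    (\<Sum>(d, b)\<in>outcomes l. F (\<lambda>i. real (games_won l d b i)))"
proof (intro sum.reindex_bij_witness[where
      j = "\<lambda>(d, b). (inv \<pi> \<circ> d, \<lambda>i j. b (\<pi> i) (\<pi> j))" and
      i = "\<lambda>(d, b). (\<pi> \<circ> d, \<lambda>i j. b (inv \<pi> i) (inv \<pi> j))"])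
  have inv: "inv \<pi> permutes {1..2 ^ l}" by (rule permutes_inv[OF \<pi>])
  have [simp]: "\<pi> (inv \<pi> x) = x" "inv \<pi> (\<pi> x) = x" for x
    using permutes_inverses[OF \<pi>] by auto
  have bij: "bij (inv \<pi>)" by (rule permutes_bij[OF inv])
  have invinv: "inv (inv \<pi>) = \<pi>" by (rule inv_inv_eq[OF permutes_bij[OF \<pi>]])
  fix z assume z: "z \<in> outcomes l"
  obtain d b where [simp]: "z = (d, b)" by force
  show "(case (case z of (d, b) \<Rightarrow> (inv \<pi> \<circ> d, \<lambda>i j. b (\<pi> i) (\<pi> j))) of
      (d, b) \<Rightarrow> (\<pi> \<circ> d, \<lambda>i j. b (inv \<pi> i) (inv \<pi> j))) = z"
    by (simp add: fun_eq_iff)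
  show "(case (case z of (d, b) \<Rightarrow> (\<pi> \<circ> d, \<lambda>i j. b (inv \<pi> i) (inv \<pi> j))) of
      (d, b) \<Rightarrow> (inv \<pi> \<circ> d, \<lambda>i j. b (\<pi> i) (\<pi> j))) = z"
    by (simp add: fun_eq_iff)
  show "(case z of (d, b) \<Rightarrow> (inv \<pi> \<circ> d, \<lambda>i j. b (\<pi> i) (\<pi> j))) \<in> outcomes l"
    using z relabel_in_tournaments[OF \<pi>] permutes_compose[OF _ inv]
    by (simp add: outcomes_def del: One_nat_def)
  show "(case z of (d, b) \<Rightarrow> (\<pi> \<circ> d, \<lambda>i j. b (inv \<pi> i) (inv \<pi> j))) \<in> outcomes l"
    using z relabel_in_tournaments[OF inv] permutes_compose[OF _ \<pi>]
    by (simp add: outcomes_def del: One_nat_def)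
  show "(case (case z of (d, b) \<Rightarrow> (inv \<pi> \<circ> d, \<lambda>i j. b (\<pi> i) (\<pi> j))) of
      (d, b) \<Rightarrow> F (\<lambda>i. real (games_won l d b i))) =
    (case z of (d, b) \<Rightarrow> F (\<lambda>i. real (games_won l d b (\<pi> i))))"
    using games_won_relabel[OF bij, of l d b] by (simp add: invinv)
qed

text \<open>
  The scores of one arbitrarily chosen run of the tournament, in which the first of the two slots
  wins every duel. Every other run rearranges them.
\<close>

definition reference_scores :: "nat \<Rightarrow> nat \<Rightarrow> real" where
  "reference_scores l i = real (games_won l id (\<lambda>_ _. True) i)"

text \<open>
  Averaging exchangeability over all permutations \<open>\<pi>\<close> turns each outcome into the sum of
  \<open>F\<close> over all rearrangements of its scores. That sum is the same for every outcome.
\<close>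

lemma average_over_outcomes:
  fixes F :: "(nat \<Rightarrow> real) \<Rightarrow> real"
  assumes F: "\<And>s t. (\<forall>i\<in>{1..2 ^ l}. s i = t i) \<Longrightarrow> F s = F t"
  shows "fact (2 ^ l) * (\<Sum>(d, b)\<in>outcomes l. F (\<lambda>i. real (games_won l d b i))) =
    real (card (outcomes l)) * (\<Sum>\<sigma>\<in>bijections {1..2 ^ l} {1..2 ^ l}. F (reference_scores l \<circ> \<sigma>))"
proof -
  let ?I = "{1..2 ^ l} :: nat set" and ?P = "{\<pi>. \<pi> permutes {1..2 ^ l}} :: (nat \<Rightarrow> nat) set"
  let ?S = "\<Sum>\<pi>\<in>?P. F (reference_scores l \<circ> \<pi>)"
  have one_outcome: "(\<Sum>\<pi>\<in>?P. F (\<lambda>i. real (games_won l d b (\<pi> i)))) = ?S"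
    if d: "d permutes ?I" for d b
  proof -
    obtain \<rho> where \<rho>: "\<rho> permutes ?I"
      "\<forall>i\<in>?I. games_won l d b i = games_won l id (\<lambda>_ _. True) (\<rho> i)"
      using games_won_rearrangement[OF d permutes_id, of b "\<lambda>_ _. True"] by blast
    have "(\<Sum>\<pi>\<in>?P. F (\<lambda>i. real (games_won l d b (\<pi> i)))) = (\<Sum>\<pi>\<in>?P. F (reference_scores l \<circ> (\<rho> \<circ> \<pi>)))"
    proof (intro sum.cong refl F ballI)
      fix \<pi> i assume "\<pi> \<in> ?P" "i \<in> ?I"
      then have "\<pi> i \<in> ?I" by (simp only: mem_Collect_eq permutes_in_image)
      then show "real (games_won l d b (\<pi> i)) = (reference_scores l \<circ> (\<rho> \<circ> \<pi>)) i"
        using \<rho>(2) by (simp add: reference_scores_def)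
    qed
    also have "\<dots> = ?S"
      using setum_permutations_compose_left[OF \<rho>(1), of "\<lambda>\<pi>. F (reference_scores l \<circ> \<pi>)"] by simp
    finally show ?thesis .
  qed
  have "fact (2 ^ l) * (\<Sum>(d, b)\<in>outcomes l. F (\<lambda>i. real (games_won l d b i))) =
    (\<Sum>\<pi>\<in>?P. \<Sum>(d, b)\<in>outcomes l. F (\<lambda>i. real (games_won l d b i)))"
    by (simp add: card_permutations)
  also have "\<dots> = (\<Sum>\<pi>\<in>?P. \<Sum>(d, b)\<in>outcomes l. F (\<lambda>i. real (games_won l d b (\<pi> i))))"
    by (rule sum.cong[OF refl], rule sum_outcomes_exchangeable[symmetric]) simp
  also have "\<dots> = (\<Sum>(d, b)\<in>outcomes l. \<Sum>\<pi>\<in>?P. F (\<lambda>i. real (games_won l d b (\<pi> i))))"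
    by (subst sum.swap) (simp add: case_prod_unfold)
  also have "\<dots> = (\<Sum>z\<in>outcomes l. ?S)"
    by (intro sum.cong refl) (auto simp: outcomes_def one_outcome simp del: One_nat_def)
  also have "?S = (\<Sum>\<sigma>\<in>bijections ?I ?I. F (reference_scores l \<circ> \<sigma>))"
    by (rule sum_permutes_eq_sum_bijections) (intro F; simp)
  finally show ?thesis by simp
qed

section \<open>The law of the draw and the duel results\<close>

text \<open>
  The common probability \<open>q\<close> can be left open: that all of them add up to 1 forces its value.
\<close>

lemma (in prob_space) distr_eq_uniform_count_measure:
  assumes Z: "Z \<in> measurable M (count_space \<Omega>)" and fin: "finite \<Omega>"
    and q: "\<And>z. z \<in> \<Omega> \<Longrightarrow> prob (Z -` {z} \<inter> space M) = q"
  shows "distr M (count_space \<Omega>) Z = uniform_count_measure \<Omega>"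
proof -
  interpret D: prob_space "distr M (count_space \<Omega>) Z" by (rule prob_space_distr[OF Z])
  have m: "measure (distr M (count_space \<Omega>) Z) {z} = q" if "z \<in> \<Omega>" for z
    using that by (simp add: measure_distr[OF Z] q)
  have "measure (distr M (count_space \<Omega>) Z) \<Omega> = (\<Sum>z\<in>\<Omega>. measure (distr M (count_space \<Omega>) Z) {z})"
    using fin by (intro D.finite_measure_eq_sum_singleton) auto
  then have "card \<Omega> * q = 1"
    using D.prob_space by (simp add: m)
  moreover from this have "card \<Omega> \<noteq> 0" by (metis mult_zero_left of_nat_0 zero_neq_one)
  ultimately have q1: "q = 1 / card \<Omega>" by (simp add: field_simps)
  show ?thesis
  proof (rule measure_eqI_finite[of _ \<Omega>])
    fix z assume z: "z \<in> \<Omega>"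
    interpret U: prob_space "uniform_count_measure \<Omega>"
      using z fin by (intro prob_space_uniform_count_measure) auto
    show "emeasure (distr M (count_space \<Omega>) Z) {z} = emeasure (uniform_count_measure \<Omega>) {z}"
      using z fin m[OF z] q1
      by (simp add: D.emeasure_eq_measure U.emeasure_eq_measure measure_uniform_count_measure)
  qed (auto simp: fin sets_uniform_count_measure)
qed

context random_knockout
begin

abbreviation players :: "nat set" where "players \<equiv> {1..2 ^ l}"

text \<open>
  The duel results as an element of \<open>tournaments players\<close>: the values that \<open>beats\<close> may
  take on the diagonal and outside the players are discarded.
\<close>

definition tournament :: "'a \<Rightarrow> nat \<Rightarrow> nat \<Rightarrow> bool" where
  "tournament \<omega> i j \<longleftrightarrow> i \<in> players \<and> j \<in> players \<and> i \<noteq> j \<and> beats i j \<omega>"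

lemma tournament_in_tournaments: "\<omega> \<in> space M \<Longrightarrow> tournament \<omega> \<in> tournaments players"
  using beats_antisym unfolding tournaments_def tournament_def by blast

lemma draw_permutes: "\<omega> \<in> space M \<Longrightarrow> draw \<omega> permutes players"
  using measurable_space[OF draw_measurable] by auto

lemma duels_players: "p \<in> duels (2 ^ l) \<longleftrightarrow> fst p \<in> players \<and> snd p \<in> players \<and> fst p < snd p"
  by (auto simp: duels_def split: prod.splits)

lemma finite_duels: "finite (duels (2 ^ l))"
  by (rule finite_subset[of _ "players \<times> players"]) (auto simp: duels_def)

lemma prob_draw_eq:
  assumes "d permutes players"
  shows "prob (draw -` {d} \<inter> space M) = 1 / fact (2 ^ l)"
proof -
  have "prob (draw -` {d} \<inter> space M) =
      measure (distr M (count_space {d. d permutes players}) draw) {d}"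
    using assms by (simp add: measure_distr[OF draw_measurable] del: One_nat_def)
  also have "\<dots> = 1 / fact (2 ^ l)"
    unfolding draw_uniform using assms
    by (simp add: measure_uniform_count_measure finite_permutations card_permutations)
  finally show ?thesis .
qed

lemma beats_measurable:
  assumes "p \<in> duels (2 ^ l)"
  shows "(\<lambda>\<omega>. beats (fst p) (snd p) \<omega>) \<in> measurable M (count_space UNIV)"
proof -
  have "random_variable (count_space UNIV) ((\<lambda>(i, j). beats i j) p)"
    using beats_indep assms unfolding indep_vars_def2 by blast
  then show ?thesis by (simp add: case_prod_unfold)
qed

lemma prob_duel_result:
  assumes p: "p \<in> duels (2 ^ l)"
  shows "prob {\<omega> \<in> space M. beats (fst p) (snd p) \<omega> = x} = 1 / 2"
proof -
  have fair: "prob {\<omega> \<in> space M. beats (fst p) (snd p) \<omega>} = 1 / 2"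
    using p by (intro beats_fair) (auto simp: duels_players)
  have ev: "{\<omega> \<in> space M. beats (fst p) (snd p) \<omega>} \<in> events"
    using beats_measurable[OF p] by (rule predE)
  show ?thesis
  proof (cases x)
    case True
    then show ?thesis using fair by simp
  next
    case False
    then show ?thesis using prob_neg[OF ev] fair by simp
  qed
qed

lemma prob_duel_results:
  "prob {\<omega> \<in> space M. \<forall>p\<in>duels (2 ^ l). beats (fst p) (snd p) \<omega> = x p} = (1 / 2) ^ card (duels (2 ^ l))"
proof (cases "duels (2 ^ l) = {}")
  case True
  then show ?thesis by (simp add: prob_space)
next
  case False
  let ?E = "\<lambda>p. {\<omega> \<in> space M. beats (fst p) (snd p) \<omega> = x p}"
  have "{\<omega> \<in> space M. \<forall>p\<in>duels (2 ^ l). beats (fst p) (snd p) \<omega> = x p} = (\<Inter>p\<in>duels (2 ^ l). ?E p)"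
    using False by auto
  also have "prob \<dots> = (\<Prod>p\<in>duels (2 ^ l). prob (?E p))"
  proof (rule indep_setsD)
    show "indep_sets (\<lambda>p. {(\<lambda>(i, j). beats i j) p -` A \<inter> space M |A. A \<in> sets (count_space UNIV)}) (duels (2 ^ l))"
      using beats_indep unfolding indep_vars_def2 by blast
    show "\<forall>p\<in>duels (2 ^ l). ?E p \<in> {(\<lambda>(i, j). beats i j) p -` A \<inter> space M |A. A \<in> sets (count_space UNIV)}"
    proof
      fix p assume "p \<in> duels (2 ^ l)"
      have "?E p = (\<lambda>(i, j). beats i j) p -` {x p} \<inter> space M" by (auto simp: case_prod_unfold)
      then show "?E p \<in> {(\<lambda>(i, j). beats i j) p -` A \<inter> space M |A. A \<in> sets (count_space UNIV)}"
        by auto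
    qed
  qed (use False finite_duels in auto)
  also have "\<dots> = (\<Prod>p\<in>duels (2 ^ l). 1 / 2)"
    by (intro prod.cong refl prob_duel_result)
  finally show ?thesis by simp
qed

text \<open>
  A set of duel results is determined by the duels with the smaller number first, which are those
  whose independence is given.
\<close>

lemma outcome_event:
  assumes "(d, b) \<in> outcomes l"
  shows "(\<lambda>\<omega>. (draw \<omega>, tournament \<omega>)) -` {(d, b)} \<inter> space M =
    (draw -` {d} \<inter> space M) \<inter>
    {\<omega> \<in> space M. \<forall>p\<in>duels (2 ^ l). beats (fst p) (snd p) \<omega> = b (fst p) (snd p)}"
proof -
  have b: "b \<in> tournaments players" using assms by (simp add: outcomes_def)
  have "tournament \<omega> = b \<longleftrightarrow> (\<forall>p\<in>duels (2 ^ l). beats (fst p) (snd p) \<omega> = b (fst p) (snd p))"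
    if w: "\<omega> \<in> space M" for \<omega>
  proof
    assume "tournament \<omega> = b"
    then show "\<forall>p\<in>duels (2 ^ l). beats (fst p) (snd p) \<omega> = b (fst p) (snd p)"
      by (auto simp: duels_players tournament_def)
  next
    assume *: "\<forall>p\<in>duels (2 ^ l). beats (fst p) (snd p) \<omega> = b (fst p) (snd p)"
    have less: "beats i j \<omega> = b i j" if "i \<in> players" "j \<in> players" "i < j" for i j
      using bspec[OF *, of "(i, j)"] that by (simp add: duels_players)
    show "tournament \<omega> = b"
    proof (intro ext)
      fix i j
      show "tournament \<omega> i j = b i j"
      proof (cases "i \<in> players \<and> j \<in> players \<and> i \<noteq> j")
        case True
        then consider "i < j" | "j < i" by linarith
        then show ?thesis
        proof cases
          case 1
          then show ?thesis using True less by (simp add: tournament_def)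
        next
          case 2
          have "beats i j \<omega> = (\<not> beats j i \<omega>)" using True beats_antisym w by blast
          moreover have "b i j = (\<not> b j i)" using True b unfolding tournaments_def by blast
          ultimately show ?thesis using True 2 less[of j i] by (simp add: tournament_def)
        qed
      next
        case False
        then show ?thesis using b unfolding tournaments_def tournament_def by blast
      qed
    qed
  qed
  then show ?thesis by auto
qed

lemma outcome_event_prob:
  assumes z: "(d, b) \<in> outcomes l"
  shows "(\<lambda>\<omega>. (draw \<omega>, tournament \<omega>)) -` {(d, b)} \<inter> space M \<in> events" (is "?E \<in> _")
    and "prob ((\<lambda>\<omega>. (draw \<omega>, tournament \<omega>)) -` {(d, b)} \<inter> space M) =
      1 / fact (2 ^ l) * (1 / 2) ^ card (duels (2 ^ l))"
proof -
  let ?D = "{d. d permutes players}"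
  let ?A = "draw -` {d} \<inter> space M"
  let ?B = "{\<omega> \<in> space M. \<forall>p\<in>duels (2 ^ l). beats (fst p) (snd p) \<omega> = b (fst p) (snd p)}"
  let ?f = "\<lambda>\<omega>. \<lambda>(i, j)\<in>duels (2 ^ l). beats i j \<omega>"
  let ?P = "Pi\<^sub>M (duels (2 ^ l)) (\<lambda>_. count_space UNIV) :: (nat \<times> nat \<Rightarrow> bool) measure"
  have d: "d permutes players" using z by (simp add: outcomes_def)
  have A: "?A \<in> sets (vimage_algebra (space M) draw (count_space ?D))"
    using d by (intro in_vimage_algebra) auto
  have "(\<Pi>\<^sub>E p\<in>duels (2 ^ l). {b (fst p) (snd p)}) \<in> sets ?P"
    by (rule sets_PiM_I_finite) (auto simp: finite_duels)
  then have "?f -` (\<Pi>\<^sub>E p\<in>duels (2 ^ l). {b (fst p) (snd p)}) \<inter> space M \<in> sets (vimage_algebra (space M) ?f ?P)"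
    by (rule in_vimage_algebra)
  also have "?f -` (\<Pi>\<^sub>E p\<in>duels (2 ^ l). {b (fst p) (snd p)}) \<inter> space M = ?B"
    by (auto simp: PiE_def Pi_def case_prod_unfold)
  finally have B: "?B \<in> sets (vimage_algebra (space M) ?f ?P)" .
  show "?E \<in> events"
    unfolding outcome_event[OF z]
    using indep_setD_ev1[OF draw_indep] indep_setD_ev2[OF draw_indep] A B by blast
  show "prob ?E = 1 / fact (2 ^ l) * (1 / 2) ^ card (duels (2 ^ l))"
    unfolding outcome_event[OF z] indep_setD[OF draw_indep A B] prob_draw_eq[OF d] prob_duel_results ..
qed

lemma outcome_measurable:
  "(\<lambda>\<omega>. (draw \<omega>, tournament \<omega>)) \<in> measurable M (count_space (outcomes l))"
  unfolding measurable_count_space_eq2[OF finite_outcomes]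
proof (intro conjI ballI funcsetI)
  fix \<omega> assume "\<omega> \<in> space M"
  then show "(draw \<omega>, tournament \<omega>) \<in> outcomes l"
    by (simp add: outcomes_def draw_permutes tournament_in_tournaments del: One_nat_def)
next
  fix z assume "z \<in> outcomes l"
  then show "(\<lambda>\<omega>. (draw \<omega>, tournament \<omega>)) -` {z} \<inter> space M \<in> events"
    using outcome_event_prob(1)[of "fst z" "snd z"] by simp
qed

lemma outcome_uniform:
  "distr M (count_space (outcomes l)) (\<lambda>\<omega>. (draw \<omega>, tournament \<omega>)) =
    uniform_count_measure (outcomes l)"
proof (rule distr_eq_uniform_count_measure[OF outcome_measurable finite_outcomes])
  fix z assume "z \<in> outcomes l"
  then show "prob ((\<lambda>\<omega>. (draw \<omega>, tournament \<omega>)) -` {z} \<inter> space M) =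
      1 / fact (2 ^ l) * (1 / 2) ^ card (duels (2 ^ l))"
    using outcome_event_prob(2)[of "fst z" "snd z"] by simp
qed

lemma games_won_tournament:
  "\<omega> \<in> space M \<Longrightarrow> games_won l (draw \<omega>) (\<lambda>j k. beats j k \<omega>) i = games_won l (draw \<omega>) (tournament \<omega>) i"
  by (rule games_won_cong[OF draw_permutes]) (auto simp: tournament_def)

lemma games_won_measurable:
  "(\<lambda>\<omega>. real (games_won l (draw \<omega>) (\<lambda>j k. beats j k \<omega>) i)) \<in> borel_measurable M"
proof -
  have "(\<lambda>(d, b). real (games_won l d b i)) \<in> measurable (count_space (outcomes l)) borel" by simp
  from measurable_compose[OF outcome_measurable this]
  show ?thesis by (subst measurable_cong[OF arg_cong[OF games_won_tournament]]) (auto)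
qed

text \<open>
  The joint law of the scores is that of a uniformly random arrangement of
  \<open>reference_scores l\<close>.
\<close>

lemma expectation_of_scores:
  fixes F :: "(nat \<Rightarrow> real) \<Rightarrow> real"
  assumes F: "\<And>s t. (\<forall>i\<in>players. s i = t i) \<Longrightarrow> F s = F t"
  shows "expectation (\<lambda>\<omega>. F (\<lambda>i. real (games_won l (draw \<omega>) (\<lambda>j k. beats j k \<omega>) i))) =
    (\<Sum>\<sigma>\<in>bijections players players. F (reference_scores l \<circ> \<sigma>)) / fact (2 ^ l)"
proof -
  let ?Z = "\<lambda>\<omega>. (draw \<omega>, tournament \<omega>)"
  let ?G = "\<lambda>(d, b). F (\<lambda>i. real (games_won l d b i))"
  have "outcomes l \<noteq> {}"
    using not_empty measurable_space[OF outcome_measurable] by fastforce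
  then have card: "card (outcomes l) \<noteq> 0" by (simp add: finite_outcomes)
  have "expectation (\<lambda>\<omega>. F (\<lambda>i. real (games_won l (draw \<omega>) (\<lambda>j k. beats j k \<omega>) i))) =
      expectation (\<lambda>\<omega>. ?G (?Z \<omega>))"
    by (intro Bochner_Integration.integral_cong) (auto simp: games_won_tournament)
  also have "\<dots> = integral\<^sup>L (distr M (count_space (outcomes l)) ?Z) ?G"
    by (intro integral_distr[symmetric] outcome_measurable) simp
  also have "\<dots> = sum ?G (outcomes l) / card (outcomes l)"
    unfolding outcome_uniform by (rule integral_uniform_count_measure[OF finite_outcomes])
  also have "\<dots> = (\<Sum>\<sigma>\<in>bijections players players. F (reference_scores l \<circ> \<sigma>)) / fact (2 ^ l)"
    using average_over_outcomes[OF F] card by (simp add: field_simps)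
  finally show ?thesis .
qed

end

section \<open>Negative association of the scores\<close>

lemma (in prob_space) covariance_eq:
  assumes "integrable M X" "integrable M Y" "integrable M (\<lambda>\<omega>. X \<omega> * Y \<omega>)"
  shows "covariance M X Y = expectation (\<lambda>\<omega>. X \<omega> * Y \<omega>) - expectation X * expectation Y"
  unfolding covariance_def using assms by (simp add: algebra_simps prob_space)

theorem proposition3p1:
  fixes M :: "'a measure"
    and l :: nat
    and draw :: "'a \<Rightarrow> nat \<Rightarrow> nat"
    and beats :: "nat \<Rightarrow> nat \<Rightarrow> 'a \<Rightarrow> bool"
  assumes "random_knockout M l draw beats"
  shows "negatively_associated M {1..2 ^ l}
           (\<lambda>i \<omega>. real (games_won l (draw \<omega>) (\<lambda>j k. beats j k \<omega>) i))"
proof -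
  interpret random_knockout M l draw beats by (rule assms)
  let ?S = "\<lambda>\<omega> i. real (games_won l (draw \<omega>) (\<lambda>j k. beats j k \<omega>) i)"
  show ?thesis
    unfolding negatively_associated_def
  proof (intro conjI ballI allI impI)
    show "(\<lambda>\<omega>. ?S \<omega> i) \<in> borel_measurable M" for i by (rule games_won_measurable)
    fix A B and f0 g0 :: "(nat \<Rightarrow> real) \<Rightarrow> real"
    assume AB: "A \<subseteq> players" "B \<subseteq> players" "A \<inter> B = {}"
      and mono: "mono_on (A \<rightarrow>\<^sub>E UNIV) f0" "mono_on (B \<rightarrow>\<^sub>E UNIV) g0"
      and int: "integrable M (\<lambda>\<omega>. f0 (\<lambda>i\<in>A. ?S \<omega> i))" "integrable M (\<lambda>\<omega>. g0 (\<lambda>i\<in>B. ?S \<omega> i))"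
        "integrable M (\<lambda>\<omega>. f0 (\<lambda>i\<in>A. ?S \<omega> i) * g0 (\<lambda>i\<in>B. ?S \<omega> i))"
    define f g where "f s = f0 (restrict s A)" and "g s = g0 (restrict s B)" for s
    have f: "increasing_in A f" and g: "increasing_in B g"
      unfolding f_def g_def by (intro increasing_in_restrict mono)+
    have local: "f s = f t" "g s = g t" if "\<forall>i\<in>players. s i = t i" for s t
      using that AB by (auto intro!: increasing_in_cong[OF f] increasing_in_cong[OF g])
    let ?avg = "\<lambda>F. (\<Sum>\<sigma>\<in>bijections players players. F (reference_scores l \<circ> \<sigma>)) / fact (2 ^ l) :: real"
    have E: "expectation (\<lambda>\<omega>. f (?S \<omega>)) = ?avg f" "expectation (\<lambda>\<omega>. g (?S \<omega>)) = ?avg g"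
      "expectation (\<lambda>\<omega>. f (?S \<omega>) * g (?S \<omega>)) = ?avg (\<lambda>s. f s * g s)"
      by (rule expectation_of_scores; simp only: local)+
    have "covariance M (\<lambda>\<omega>. f (?S \<omega>)) (\<lambda>\<omega>. g (?S \<omega>)) =
        expectation (\<lambda>\<omega>. f (?S \<omega>) * g (?S \<omega>)) - expectation (\<lambda>\<omega>. f (?S \<omega>)) * expectation (\<lambda>\<omega>. g (?S \<omega>))"
      by (rule covariance_eq) (use int in \<open>simp_all add: f_def g_def\<close>)
    also have "\<dots> \<le> 0"
      unfolding E
      using permutation_distribution_negatively_associated[OF _ _ refl f g AB(3), of players "reference_scores l"]
      by (simp add: field_simps)
    finally show "covariance M (\<lambda>\<omega>. f0 (\<lambda>i\<in>A. ?S \<omega> i)) (\<lambda>\<omega>. g0 (\<lambda>i\<in>B. ?S \<omega> i)) \<le> 0"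
      by (simp add: f_def g_def)
  qed
qed

end
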